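(* Let $\mathcal{L}:\mathbb{R}\to\mathbb{R}$ be twice differentiable with global minimum at $\theta^\star=0$ and $\mathcal{L}''(0)=a>0$. Let $b>0$ and assume that the valley $V=[-2b,2b]$ is sub-quadratic for $\mathcal{L}$. Then for every initialization $\theta^0\in(-b,b)$ and all $\eta>0$, $\rho\ge0$ satisfying $$\eta<\inf_{z\in V}\frac{b}{|\mathcal{L}'(z)|},\qquad \rho\le\min\left\{\frac1a,\ \eta,\ \eta\inf_{0<|z|<b}\left|\frac{\mathcal{L}'(2z)}{\mathcal{L}'(z)}\right|\right\},$$ the full-batch SAM iterates $$\theta^{t+1}=\theta^t-\eta\,\mathcal{L}'\big(\theta^t+\rho\,\mathcal{L}'(\theta^t)\big)$$ remain in the valley: $\theta^t\in V$ for all $t\in\mathbb{N}$.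
   Context: **Sub-quadratic valley.** Let $\mathcal{L}:\mathbb{R}\to\mathbb{R}$ be twice differentiable with global minimum at $0$ and $\mathcal{L}''(0)=a>0$. The valley $V=[-c,c]$ is called sub-quadratic if (i) $z\mathcal{L}'(z)\ge0$ for all $z\in V$; and (ii) on each side of $0$ the second derivative is non-increasing in $|z|$: for all $z_1,z_2\in[0,c]$, and likewise for all $z_1,z_2\in[-c,0]$, with $|z_1|\le|z_2|$, one has $\mathcal{L}''(z_1)\ge\mathcal{L}''(z_2)$. **Conventions.** $b/|\mathcal{L}'(z)|=+\infty$ when $\mathcal{L}'(z)=0$, and the infimum of $|\mathcal{L}'(2z)/\mathcal{L}'(z)|$ is taken over those $z$ with $0<|z|<b$ and $\mathcal{L}'(z)\neq0$. *)

theory Defs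
  imports "HOL-Analysis.Analysis"
begin

definition twice_differentiable :: "(real \<Rightarrow> real) \<Rightarrow> bool" where
  "twice_differentiable L \<longleftrightarrow>
     (\<forall>x. L differentiable (at x)) \<and> (\<forall>x. deriv L differentiable (at x))"

text \<open>
  The valley \<open>{- c..c}\<close> of a loss \<open>L\<close>. The standing hypotheses on \<open>L\<close> (twice differentiable,
  global minimum at \<open>0\<close>, positive second derivative there) are not part of this predicate and
  have to be assumed alongside it.
\<close>
definition subquadratic_valley :: "(real \<Rightarrow> real) \<Rightarrow> real \<Rightarrow> bool" where
  "subquadratic_valley L c \<longleftrightarrow>
     (\<forall>z\<in>{- c..c}. z * deriv L z \<ge> 0) \<and>
     (\<forall>z1\<in>{0..c}. \<forall>z2\<in>{0..c}. \<bar>z1\<bar> \<le> \<bar>z2\<bar> \<longrightarrow> deriv (deriv L) z1 \<ge> deriv (deriv L) z2) \<and>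
     (\<forall>z1\<in>{- c..0}. \<forall>z2\<in>{- c..0}. \<bar>z1\<bar> \<le> \<bar>z2\<bar> \<longrightarrow> deriv (deriv L) z1 \<ge> deriv (deriv L) z2)"

text \<open>Full-batch sharpness-aware minimization (SAM) with step size \<open>\<eta>\<close> and radius \<open>\<rho>\<close>.\<close>
primrec sam :: "(real \<Rightarrow> real) \<Rightarrow> real \<Rightarrow> real \<Rightarrow> real \<Rightarrow> nat \<Rightarrow> real" where
  "sam L \<eta> \<rho> \<theta>0 0 = \<theta>0"
| "sam L \<eta> \<rho> \<theta>0 (Suc t) =
     sam L \<eta> \<rho> \<theta>0 t - \<eta> * deriv L (sam L \<eta> \<rho> \<theta>0 t + \<rho> * deriv L (sam L \<eta> \<rho> \<theta>0 t))"

end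

theory Submission
  imports Defs
begin

text \<open>
  The smaller interval \<open>(-b, b)\<close> is already invariant: from \<open>\<eta> * \<bar>L' z\<bar> < b\<close> on the valley and
  \<open>\<rho> \<le> \<eta>\<close>, the ascent step moves away from \<open>0\<close> by less than \<open>b\<close>, so the perturbed point stays
  in the valley on the same side of \<open>0\<close>, and the descent step then points towards \<open>0\<close> and is
  shorter than \<open>b\<close>.
\<close>

lemma sam_step_invariant:
  fixes g :: "real \<Rightarrow> real"
  assumes sign: "\<And>z. \<bar>z\<bar> \<le> 2 * b \<Longrightarrow> z * g z \<ge> 0"
    and bound: "\<And>z. \<bar>z\<bar> \<le> 2 * b \<Longrightarrow> \<eta> * \<bar>g z\<bar> < b"
    and "0 \<le> \<rho>" "\<rho> \<le> \<eta>" "\<bar>\<theta>\<bar> < b"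
  shows "\<bar>\<theta> - \<eta> * g (\<theta> + \<rho> * g \<theta>)\<bar> < b"
proof -
  define \<phi> where "\<phi> = \<theta> + \<rho> * g \<theta>"
  have "\<bar>\<rho> * g \<theta>\<bar> \<le> \<eta> * \<bar>g \<theta>\<bar>"
    using assms(3,4) by (simp add: abs_mult mult_right_mono)
  also have "\<dots> < b"
    using bound assms(5) by simp
  finally have \<phi>: "\<bar>\<phi>\<bar> \<le> 2 * b"
    using assms(5) unfolding \<phi>_def by linarith
  \<comment> \<open>The bound is applied at \<phi>, which may lie beyond distance \<open>b\<close>
    from 0. \<open>0 \<le> \<rho>\<close> and \<open>\<rho> \<le> \<eta>\<close> give
    \<open>\<eta> \<ge> 0\<close>.\<close>
  have step: "\<bar>\<eta> * g \<phi>\<bar> < b"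
    using bound[OF \<phi>] assms(3,4) by (simp add: abs_mult)
  have \<theta>: "\<theta> * g \<theta> \<ge> 0"
    using sign assms(5) by simp
  consider "\<theta> = 0" | "\<theta> > 0" | "\<theta> < 0"
    by linarith
  then have "\<bar>\<theta> - \<eta> * g \<phi>\<bar> < b"
  proof cases
    \<comment> \<open>At 0 the condition \<open>sign\<close> is trivial, so the side of \<phi> is
      unknown; the length of the step suffices.\<close>
    case 1
    then show ?thesis using step by simp
  next
    case 2
    then have "\<phi> > 0"
      using \<theta> assms(3) unfolding \<phi>_def by (simp add: zero_le_mult_iff add_pos_nonneg)
    then have "\<eta> * g \<phi> \<ge> 0"
      using sign[OF \<phi>] assms(3,4) by (simp add: zero_le_mult_iff)
    \<comment> \<open>The descent may overshoot 0, but by less than \<open>b\<close>.\<close>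
    then show ?thesis
      using 2 step assms(5) by linarith
  next
    case 3
    then have "\<phi> < 0"
      using \<theta> assms(3) unfolding \<phi>_def
      by (simp add: zero_le_mult_iff add_neg_nonpos mult_nonneg_nonpos)
    then have "\<eta> * g \<phi> \<le> 0"
      using sign[OF \<phi>] assms(3,4) by (simp add: zero_le_mult_iff mult_nonneg_nonpos)
    then show ?thesis
      using 3 step assms(5) by linarith
  qed
  then show ?thesis
    unfolding \<phi>_def .
qed

theorem proposition4p1:
  fixes L :: "real \<Rightarrow> real" and a b \<eta> \<rho> \<theta>0 :: real
  assumes "twice_differentiable L"
    and "\<forall>x. L 0 \<le> L x"
    and "deriv (deriv L) 0 = a"
    and "a > 0"
    and "b > 0"
    and "subquadratic_valley L (2 * b)"
    and "\<theta>0 \<in> {- b<..<b}"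
    and "\<eta> > 0"
    and "\<rho> \<ge> 0"
    and "ereal \<eta> < (INF z\<in>{- (2 * b)..2 * b}.
           if deriv L z = 0 then \<infinity> else ereal (b / \<bar>deriv L z\<bar>))"
    and "ereal \<rho> \<le> min (ereal (1 / a)) (min (ereal \<eta>)
           (ereal \<eta> * (INF z\<in>{z. 0 < \<bar>z\<bar> \<and> \<bar>z\<bar> < b \<and> deriv L z \<noteq> 0}.
              ereal \<bar>deriv L (2 * z) / deriv L z\<bar>)))"
  shows "\<forall>t. sam L \<eta> \<rho> \<theta>0 t \<in> {- (2 * b)..2 * b}"
proof -
  have sign: "z * deriv L z \<ge> 0" if "\<bar>z\<bar> \<le> 2 * b" for z
    using assms(6) that unfolding subquadratic_valley_def by (auto simp: abs_le_iff)
  have bound: "\<eta> * \<bar>deriv L z\<bar> < b" if "\<bar>z\<bar> \<le> 2 * b" for z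
  \<comment> \<open>At a critical point the infimum ranges over \<infinity> and gives no bound, but
    there the product is 0.\<close>
  proof (cases "deriv L z = 0")
    case True
    then show ?thesis using assms(5) by simp
  next
    case False
    have "z \<in> {- (2 * b)..2 * b}"
      using that by auto
    from less_INF_D[OF assms(10) this] False show ?thesis
      by (simp add: pos_less_divide_eq)
  qed
  have "\<rho> \<le> \<eta>"
    using assms(11) by simp
  \<comment> \<open>The induction carries the strict bound by \<open>b\<close>, which
    \<open>sam_step_invariant\<close> both requires and returns.\<close>
  have "\<bar>sam L \<eta> \<rho> \<theta>0 t\<bar> < b" for t
  proof (induction t)
    case 0
    then show ?case using assms(7) by auto
  next
    case (Suc t)
    then show ?case
      using sam_step_invariant[OF sign bound assms(9) \<open>\<rho> \<le> \<eta>\<close>] by simp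
  qed
  then have "- b < sam L \<eta> \<rho> \<theta>0 t" "sam L \<eta> \<rho> \<theta>0 t < b" for t
    by (simp_all add: abs_less_iff minus_less_iff)
  moreover have "{- b<..<b} \<subseteq> {- (2 * b)..2 * b}"
    using assms(5) by auto
  ultimately show ?thesis
    by (meson greaterThanLessThan_iff subsetD)
qed

end
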